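(* Let $X$ be a time-homogeneous Markov process on a Polish space $\mathbb{X}$ with transition kernel $Q$, $f:\mathbb{X}\to[0,\infty)$ a bounded Borel payoff function, and $\delta:\{0,1,2,\dots\}\to[0,1]$ a strictly decreasing discount function with $\delta(0)=1$ and $\lim_{k\to\infty}\delta(k)=0$. Suppose that $\delta(i)\delta(j)\le\delta(i+j)$ for all $i,j=0,1,2,\dots$, and that $f$ is upper semicontinuous. In addition, assume that for any bounded Borel measurable $g:\mathbb{X}\to\mathbb{R}$ and any sequence $(x_n)_{n\in\mathbb{N}}$ in $\mathbb{X}$ with $x_n\to x\in\mathbb{X}$, $$\liminf_{n\to\infty}\int_{\mathbb{X}} g(y)\,Q(x_n,dy)\ \ge\ \int_{\mathbb{X}} g(y)\,Q(x,dy).$$ Then $S^*:=\bigcap_{S\in\mathcal{E}}S$, the intersection of all equilibria, is the optimal equilibrium.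
   Context: Setting. $\mathbb{X}$ is a Polish space with Borel $\sigma$-algebra $\mathcal{B}(\mathbb{X})$; $X=(X_t)_{t=0,1,2,\dots}$ is a time-homogeneous $\mathbb{X}$-valued Markov process with transition kernel $Q$, i.e. $\mathbb{P}(X_{t+1}\in A\mid X_t=x)=\int_A Q(x,dy)$ for all $t\ge 0$, $x\in\mathbb{X}$, $A\in\mathcal{B}(\mathbb{X})$. Write $X^x$ for the process started at $X_0=x$ and $\mathbb{E}^x$ for expectation conditional on $X_0=x$. Stopping times are with respect to the filtration generated by $X$ and may take the value $\infty$. For $x\in\mathbb{X}$ and a stopping time $\tau$, $J(x,\tau):=\mathbb{E}^x[\delta(\tau)f(X_\tau)]$, where $\delta(\tau)f(X_\tau):=0$ on $\{\tau=\infty\}$. For $S\in\mathcal{B}(\mathbb{X})$, $\rho(x,S):=\inf\{t\ge 1: X^x_t\in S\}$ (with $\inf\emptyset=\infty$), and $$\Theta(S):=\{x\in\mathbb{X}: f(x)\ge J(x,\rho(x,S))\}\in\mathcal{B}(\mathbb{X}).$$ A set $S\in\mathcal{B}(\mathbb{X})$ is called an equilibrium if $\Theta(S)=S$; $\mathcal{E}$ denotes the set of all equilibria. For $S\in\mathcal{E}$, the value function is $V(x,S):=f(x)\vee J(x,\rho(x,S))$, $x\in\mathbb{X}$. An equilibrium $S^*\in\mathcal{E}$ is called an optimal equilibrium if for every $S\in\mathcal{E}$, $V(x,S^* )\ge V(x,S)$ for all $x\in\mathbb{X}$. *)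

theory Defs
  imports "HOL-Probability.Probability"
begin

definition upper_semicontinuous :: "('a::topological_space \<Rightarrow> real) \<Rightarrow> bool" where
  "upper_semicontinuous f \<longleftrightarrow> (\<forall>x. Limsup (at x) (\<lambda>y. ereal (f y)) \<le> ereal (f x))"

definition natural_filtration ::
  "'w measure \<Rightarrow> (nat \<Rightarrow> 'w \<Rightarrow> 'a::topological_space) \<Rightarrow> nat \<Rightarrow> 'w measure" where
  "natural_filtration M X t =
     sigma (space M) {X s -` A \<inter> space M | s A. s \<le> t \<and> A \<in> sets borel}"

text \<open>
  A time-homogeneous Markov process with kernel \<open>Q\<close>, in the usual formulation as one process
  \<open>X\<close> on a measurable space (of \<open>M\<close>, only space and sigma-algebra matter) under a family of
  laws \<open>P x\<close>; the process started at \<open>x\<close> is \<open>X\<close> under \<open>P x\<close>.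
\<close>

locale markov_process =
  fixes M :: "'w measure"
    and P :: "'a::polish_space \<Rightarrow> 'w measure"
    and X :: "nat \<Rightarrow> 'w \<Rightarrow> 'a"
    and Q :: "'a \<Rightarrow> 'a measure"
  assumes kernel: "Q \<in> borel \<rightarrow>\<^sub>M prob_algebra borel"
    and law: "\<And>x. P x \<in> space (prob_algebra M)"
    and process_measurable: "\<And>t. X t \<in> M \<rightarrow>\<^sub>M borel"
    and start: "\<And>x. AE \<omega> in P x. X 0 \<omega> = x"
    and markov: "\<And>x t A. A \<in> sets borel \<Longrightarrow>
      AE \<omega> in P x. real_cond_exp (P x) (natural_filtration M X t)
          (indicator (X (Suc t) -` A \<inter> space M)) \<omega> = measure (Q (X t \<omega>)) A"

text \<open>The expected payoff \<open>J(x, \<tau>)\<close>, meant for stopping times \<open>\<tau>\<close> with values in \<open>enat\<close>.\<close>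

definition expected_payoff ::
  "('a \<Rightarrow> 'w measure) \<Rightarrow> (nat \<Rightarrow> 'w \<Rightarrow> 'a) \<Rightarrow> (nat \<Rightarrow> real) \<Rightarrow> ('a \<Rightarrow> real) \<Rightarrow> 'a \<Rightarrow> ('w \<Rightarrow> enat) \<Rightarrow> real"
  where
  "expected_payoff P X \<delta> f x \<tau> =
     (\<integral>\<omega>. (case \<tau> \<omega> of enat t \<Rightarrow> \<delta> t * f (X t \<omega>) | \<infinity> \<Rightarrow> 0) \<partial>P x)"

text \<open>
  \<open>\<rho>(x, S)\<close> depends on \<open>x\<close> only through the law \<open>P x\<close> under which it is evaluated.
  The infimum of the empty set in \<open>enat\<close> is \<open>\<infinity>\<close>.
\<close>

definition return_time :: "(nat \<Rightarrow> 'w \<Rightarrow> 'a) \<Rightarrow> 'a set \<Rightarrow> 'w \<Rightarrow> enat" where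
  "return_time X S \<omega> = Inf {enat t | t. 1 \<le> t \<and> X t \<omega> \<in> S}"

definition Theta ::
  "('a \<Rightarrow> 'w measure) \<Rightarrow> (nat \<Rightarrow> 'w \<Rightarrow> 'a) \<Rightarrow> (nat \<Rightarrow> real) \<Rightarrow> ('a \<Rightarrow> real) \<Rightarrow> 'a set \<Rightarrow> 'a set" where
  "Theta P X \<delta> f S = {x. f x \<ge> expected_payoff P X \<delta> f x (return_time X S)}"

definition equilibria ::
  "('a::topological_space \<Rightarrow> 'w measure) \<Rightarrow> (nat \<Rightarrow> 'w \<Rightarrow> 'a) \<Rightarrow> (nat \<Rightarrow> real) \<Rightarrow> ('a \<Rightarrow> real) \<Rightarrow> 'a set set"
  where
  "equilibria P X \<delta> f = {S \<in> sets borel. Theta P X \<delta> f S = S}"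

definition value_function ::
  "('a \<Rightarrow> 'w measure) \<Rightarrow> (nat \<Rightarrow> 'w \<Rightarrow> 'a) \<Rightarrow> (nat \<Rightarrow> real) \<Rightarrow> ('a \<Rightarrow> real) \<Rightarrow> 'a \<Rightarrow> 'a set \<Rightarrow> real" where
  "value_function P X \<delta> f x S = max (f x) (expected_payoff P X \<delta> f x (return_time X S))"

definition optimal_equilibrium ::
  "('a::topological_space \<Rightarrow> 'w measure) \<Rightarrow> (nat \<Rightarrow> 'w \<Rightarrow> 'a) \<Rightarrow> (nat \<Rightarrow> real) \<Rightarrow> ('a \<Rightarrow> real) \<Rightarrow> 'a set \<Rightarrow> bool"
  where
  "optimal_equilibrium P X \<delta> f S \<longleftrightarrow>
     S \<in> equilibria P X \<delta> f \<and>
     (\<forall>T \<in> equilibria P X \<delta> f. \<forall>x. value_function P X \<delta> f x S \<ge> value_function P X \<delta> f x T)"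

end

theory Submission
  imports Defs
begin

text \<open>
  The expected payoff of stopping at the first return to \<open>S\<close> is a discounted sum of iterated kernel
  integrals, so it satisfies a one-step recursion in the discount delay, and comparing two return
  times needs no strong Markov property. Under the liminf hypothesis (applied to \<open>g\<close> and \<open>- g\<close>) this
  payoff is continuous in the starting point, so \<open>\<Theta>(S)\<close> is closed for every Borel \<open>S\<close>.

  Call a closed set \<open>R\<close> good if \<open>\<Theta>(R) \<subseteq> R\<close>; every equilibrium is good. Shrinking good sets increases
  the payoff: the intersection \<open>R\<close> of all good sets has the largest payoff among them, and
  \<open>\<Theta>(R)\<close> has an even larger one. Hence both \<open>R\<close> and \<open>\<Theta>(R)\<close> are good, and minimality of \<open>R\<close>
  gives \<open>\<Theta>(R) = R\<close>. So \<open>R\<close> is an equilibrium, the smallest one, and optimal.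
\<close>

section \<open>First-return payoffs as iterated kernel integrals\<close>

text \<open>For the chain started at \<open>x\<close>, index \<open>t\<close> stands for a first
  return at time \<open>t + 1\<close>: the value is the expectation of \<open>f\<close> at that time
  on that event. Values in \<open>ennreal\<close> let sums and integrals be exchanged without
  integrability conditions.\<close>

fun first_return_payoff ::
  "('a \<Rightarrow> 'a measure) \<Rightarrow> ('a \<Rightarrow> ennreal) \<Rightarrow> 'a set \<Rightarrow> nat \<Rightarrow> 'a \<Rightarrow> ennreal" where
  "first_return_payoff Q f S 0 x = (\<integral>\<^sup>+y. indicator S y * f y \<partial>Q x)"
| "first_return_payoff Q f S (Suc t) x =
     (\<integral>\<^sup>+y. indicator (- S) y * first_return_payoff Q f S t y \<partial>Q x)"

text \<open>This is the expectation of \<open>\<delta> (k + \<rho>) * f\<close> at the return time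
  \<rho>; \<open>k = 0\<close> gives J. The delay \<open>k\<close> is carried along because \<delta>
  need not be multiplicative, so the discount of an elapsed step cannot be factored out.\<close>

definition delayed_payoff ::
  "('a \<Rightarrow> 'a measure) \<Rightarrow> (nat \<Rightarrow> real) \<Rightarrow> ('a \<Rightarrow> ennreal) \<Rightarrow> 'a set \<Rightarrow> nat \<Rightarrow> 'a \<Rightarrow> ennreal" where
  "delayed_payoff Q \<delta> f S k x =
     (\<Sum>t. ennreal (\<delta> (k + Suc t)) * first_return_payoff Q f S t x)"

context
  fixes Q :: "'a::topological_space \<Rightarrow> 'a measure"
  assumes kernel: "Q \<in> borel \<rightarrow>\<^sub>M prob_algebra borel"
begin

lemma sets_kernel [measurable_cong]: "sets (Q x) = sets borel"
  using measurable_space[OF kernel, of x] by (simp add: space_prob_algebra)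

lemma prob_space_kernel: "prob_space (Q x)"
  using measurable_space[OF kernel, of x] by (simp add: space_prob_algebra)

lemma nn_integral_kernel_measurable:
  assumes "g \<in> borel_measurable borel"
  shows "(\<lambda>x. \<integral>\<^sup>+y. g y \<partial>Q x) \<in> borel_measurable borel"
  using measurable_compose[OF measurable_prob_algebraD[OF kernel]
      nn_integral_measurable_subprob_algebra[OF assms]] .

lemma nn_integral_kernel_bound:
  assumes "\<And>y. g y \<le> c"
  shows "(\<integral>\<^sup>+y. g y \<partial>Q x) \<le> c"
proof -
  interpret prob_space "Q x" by (rule prob_space_kernel)
  have "(\<integral>\<^sup>+y. g y \<partial>Q x) \<le> (\<integral>\<^sup>+y. c \<partial>Q x)"
    by (intro nn_integral_mono assms)
  then show ?thesis by (simp add: emeasure_space_1)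
qed

context
  fixes f :: "'a \<Rightarrow> ennreal"
  assumes f [measurable]: "f \<in> borel_measurable borel"
begin

lemma first_return_payoff_measurable [measurable]:
  assumes [measurable]: "S \<in> sets borel"
  shows "first_return_payoff Q f S t \<in> borel_measurable borel"
proof (induction t)
  case 0
  show ?case
    using nn_integral_kernel_measurable[of "\<lambda>y. indicator S y * f y"] by simp
next
  case (Suc t)
  note [measurable] = Suc
  show ?case
    using nn_integral_kernel_measurable[of "\<lambda>y. indicator (- S) y * first_return_payoff Q f S t y"]
    by simp
qed

lemma delayed_payoff_measurable [measurable]:
  assumes [measurable]: "S \<in> sets borel"
  shows "delayed_payoff Q \<delta> f S k \<in> borel_measurable borel"
  unfolding delayed_payoff_def by measurable

text \<open>Conditioning on the first step: in \<open>S\<close> the payoff is collected with delay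
  \<open>Suc k\<close>; outside \<open>S\<close> the same problem restarts with delay
  \<open>Suc k\<close>. Formally, the term \<open>t = 0\<close> is split off and the remaining
  series is moved inside the integral.\<close>

lemma delayed_payoff_rec:
  assumes [measurable]: "S \<in> sets borel"
  shows "delayed_payoff Q \<delta> f S k x =
    (\<integral>\<^sup>+y. ennreal (\<delta> (Suc k)) * (indicator S y * f y)
        + indicator (- S) y * delayed_payoff Q \<delta> f S (Suc k) y \<partial>Q x)"
proof -
  have tail: "ennreal (\<delta> (k + Suc (Suc t))) * first_return_payoff Q f S (Suc t) x =
      (\<integral>\<^sup>+y. indicator (- S) y * (ennreal (\<delta> (Suc k + Suc t)) * first_return_payoff Q f S t y) \<partial>Q x)"
    for t
    by (simp add: nn_integral_cmult[symmetric] mult_ac)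
  have "delayed_payoff Q \<delta> f S k x = ennreal (\<delta> (Suc k)) * first_return_payoff Q f S 0 x
      + (\<Sum>t. ennreal (\<delta> (k + Suc (Suc t))) * first_return_payoff Q f S (Suc t) x)"
    unfolding delayed_payoff_def by (subst suminf_offset[of _ 1]) auto
  also have "\<dots> = (\<integral>\<^sup>+y. ennreal (\<delta> (Suc k)) * (indicator S y * f y) \<partial>Q x)
      + (\<integral>\<^sup>+y. indicator (- S) y * delayed_payoff Q \<delta> f S (Suc k) y \<partial>Q x)"
    unfolding tail delayed_payoff_def
    by (simp add: nn_integral_cmult nn_integral_suminf[symmetric] ennreal_suminf_cmult)
  also have "\<dots> = (\<integral>\<^sup>+y. ennreal (\<delta> (Suc k)) * (indicator S y * f y)
        + indicator (- S) y * delayed_payoff Q \<delta> f S (Suc k) y \<partial>Q x)"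
    by (rule nn_integral_add[symmetric]) measurable
  finally show ?thesis .
qed

text \<open>First returns at different times are disjoint events, so their total weight is at most
  1. In the induction, one step leaves an integrand that is either \<open>f y\<close> or a shorter
  partial sum started at \<open>y\<close>, both at most \<open>B\<close>.\<close>

lemma suminf_first_return_payoff_le:
  assumes [measurable]: "S \<in> sets borel" and bound: "\<And>y. f y \<le> B"
  shows "(\<Sum>t. first_return_payoff Q f S t x) \<le> B"
proof (rule suminf_le_const)
  show "summable (\<lambda>t. first_return_payoff Q f S t x)" by simp
  show "(\<Sum>t<n. first_return_payoff Q f S t x) \<le> B" for n
  proof (induction n arbitrary: x)
    case 0
    show ?case by simp
  next
    case (Suc n)
    have "(\<Sum>t<Suc n. first_return_payoff Q f S t x)
        = first_return_payoff Q f S 0 x + (\<Sum>t<n. first_return_payoff Q f S (Suc t) x)"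
      by (rule sum.lessThan_Suc_shift)
    also have "\<dots> = (\<integral>\<^sup>+y. indicator S y * f y
        + (\<Sum>t<n. indicator (- S) y * first_return_payoff Q f S t y) \<partial>Q x)"
    proof -
      have "(\<integral>\<^sup>+y. (\<Sum>t<n. indicator (- S) y * first_return_payoff Q f S t y) \<partial>Q x)
          = (\<Sum>t<n. first_return_payoff Q f S (Suc t) x)"
        by (subst nn_integral_sum) simp_all
      then show ?thesis
        by (subst nn_integral_add; (measurable | simp))
    qed
    also have "\<dots> = (\<integral>\<^sup>+y. indicator S y * f y
        + indicator (- S) y * (\<Sum>t<n. first_return_payoff Q f S t y) \<partial>Q x)"
      by (simp only: sum_distrib_left)
    also have "\<dots> \<le> B"
      by (intro nn_integral_kernel_bound) (auto simp: indicator_def bound Suc)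
    finally show ?case .
  qed
qed

lemma delayed_payoff_le:
  assumes "S \<in> sets borel" and "\<And>y. f y \<le> B" and "antimono \<delta>"
  shows "delayed_payoff Q \<delta> f S k x \<le> ennreal (\<delta> (Suc k)) * B"
proof -
  have "delayed_payoff Q \<delta> f S k x
      \<le> (\<Sum>t. ennreal (\<delta> (Suc k)) * first_return_payoff Q f S t x)"
    unfolding delayed_payoff_def
    by (intro suminf_le mult_right_mono ennreal_leI antimonoD[OF assms(3)]) auto
  also have "\<dots> = ennreal (\<delta> (Suc k)) * (\<Sum>t. first_return_payoff Q f S t x)"
    by simp
  also have "\<dots> \<le> ennreal (\<delta> (Suc k)) * B"
    by (intro mult_left_mono suminf_first_return_payoff_le assms) auto
  finally show ?thesis .
qed

text \<open>Here the inequality for \<open>\<delta> i * \<delta> j\<close> enters: postponing a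
  problem by \<open>k\<close> loses at most the factor \<open>\<delta> k\<close>. It holds term by
  term in the series.\<close>

lemma delayed_payoff_supermult:
  assumes "\<And>i j. \<delta> i * \<delta> j \<le> \<delta> (i + j)" and "\<And>i. 0 \<le> \<delta> i"
  shows "ennreal (\<delta> k) * delayed_payoff Q \<delta> f S 0 x \<le> delayed_payoff Q \<delta> f S k x"
proof -
  have "ennreal (\<delta> k) * (ennreal (\<delta> (0 + Suc t)) * first_return_payoff Q f S t x)
      \<le> ennreal (\<delta> (k + Suc t)) * first_return_payoff Q f S t x" for t
    using assms(1)[of k "Suc t"] assms(2)
    by (auto simp: mult.assoc[symmetric] ennreal_mult[symmetric] intro!: mult_right_mono ennreal_leI)
  then show ?thesis
    unfolding delayed_payoff_def ennreal_suminf_cmult[symmetric]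
    by (intro suminf_le) auto
qed

text \<open>
  Unrolling one step, wherever \<open>S\<close> stops outside \<open>R\<close> the stopping payoff is dominated by the
  continuation payoff of another member of the family. So an excess of a member over \<open>R\<close> can be
  pushed arbitrarily far into the future, where the discount makes it vanish.
\<close>

lemma delayed_payoff_mono:
  assumes R [measurable]: "R \<in> sets borel"
    and F: "F \<subseteq> sets borel" "\<And>S. S \<in> F \<Longrightarrow> R \<subseteq> S"
    and continue: "\<And>y. y \<notin> R \<Longrightarrow> \<exists>S\<in>F. f y \<le> delayed_payoff Q \<delta> f S 0 y"
    and bound: "\<And>y. f y \<le> ennreal B"
    and discount: "antimono \<delta>" "\<delta> \<longlonglongrightarrow> 0" "\<And>i. 0 \<le> \<delta> i"
      "\<And>i j. \<delta> i * \<delta> j \<le> \<delta> (i + j)"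
    and S: "S \<in> F"
  shows "delayed_payoff Q \<delta> f S k x \<le> delayed_payoff Q \<delta> f R k x"
proof -
  define c where "c n = ennreal (\<delta> n) * ennreal B" for n
  \<comment> \<open>The error depends only on \<open>k + n\<close>. Passing from (\<open>k\<close>,
    \<open>Suc n\<close>) to (\<open>Suc k\<close>, \<open>n\<close>) leaves it unchanged, and a
    constant survives integration against a probability kernel.\<close>
  have step: "delayed_payoff Q \<delta> f S k x \<le> delayed_payoff Q \<delta> f R k x + c (Suc (k + n))"
    if "S \<in> F" for S k n x
    using that
  proof (induction n arbitrary: S k x)
    case 0
    then have "delayed_payoff Q \<delta> f S k x \<le> c (Suc k)"
      using F(1) unfolding c_def by (intro delayed_payoff_le bound discount) auto
    then show ?case by (simp add: add_increasing)
  next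
    case (Suc n)
    have S [measurable]: "S \<in> sets borel" using Suc.prems F(1) by auto
    let ?c = "c (Suc (k + Suc n))"
    let ?g = "\<lambda>y. ennreal (\<delta> (Suc k)) * (indicator R y * f y)
        + indicator (- R) y * delayed_payoff Q \<delta> f R (Suc k) y"
    have "ennreal (\<delta> (Suc k)) * (indicator S y * f y)
        + indicator (- S) y * delayed_payoff Q \<delta> f S (Suc k) y \<le> ?g y + ?c" for y
    proof -
      \<comment> \<open>In the first and third cases \<open>S\<close> and \<open>R\<close> take the
        same decision at \<open>y\<close>. Only in the second does \<open>S\<close> stop while
        \<open>R\<close> continues; there the member \<open>T\<close> of the family takes over from
        \<open>S\<close>, which is why the induction varies the set.\<close>
      consider "y \<in> R" "y \<in> S" | "y \<notin> R" "y \<in> S" | "y \<notin> R" "y \<notin> S"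
        using F(2) Suc.prems by blast
      then show ?thesis
      proof cases
        case 1
        then show ?thesis by simp
      next
        case 2
        then obtain T where T: "T \<in> F" "f y \<le> delayed_payoff Q \<delta> f T 0 y"
          using continue by blast
        have "ennreal (\<delta> (Suc k)) * f y \<le> ennreal (\<delta> (Suc k)) * delayed_payoff Q \<delta> f T 0 y"
          using T(2) by (rule mult_left_mono) simp
        also have "\<dots> \<le> delayed_payoff Q \<delta> f T (Suc k) y"
          by (rule delayed_payoff_supermult) (rule discount)+
        also have "\<dots> \<le> delayed_payoff Q \<delta> f R (Suc k) y + ?c"
          using Suc.IH[OF T(1), of "Suc k" y] by simp
        finally show ?thesis using 2 by simp
      next
        case 3
        then show ?thesis using Suc.IH[OF Suc.prems, of "Suc k" y] by simp
      qed
    qed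
    then have "delayed_payoff Q \<delta> f S k x \<le> (\<integral>\<^sup>+y. ?g y + ?c \<partial>Q x)"
      unfolding delayed_payoff_rec[OF S, of \<delta> k x] by (intro nn_integral_mono)
    also have "\<dots> = (\<integral>\<^sup>+y. ?g y \<partial>Q x) + (\<integral>\<^sup>+y. ?c \<partial>Q x)"
      by (rule nn_integral_add) measurable
    also have "\<dots> = delayed_payoff Q \<delta> f R k x + ?c"
      using prob_space.emeasure_space_1[OF prob_space_kernel, of x]
      by (simp add: delayed_payoff_rec[OF R, of \<delta> k x])
    finally show ?case .
  qed
  have "(\<lambda>n. c (Suc k + n)) \<longlonglongrightarrow> ennreal 0 * ennreal B"
    unfolding c_def
    by (intro tendsto_mult_ennreal tendsto_ennrealI tendsto_const)
      (use LIMSEQ_ignore_initial_segment[OF discount(2), of "Suc k"] in \<open>auto simp: add.commute\<close>)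
  then have "(\<lambda>n. delayed_payoff Q \<delta> f R k x + c (Suc (k + n)))
      \<longlonglongrightarrow> delayed_payoff Q \<delta> f R k x + 0"
    by (intro tendsto_add tendsto_const) simp
  then show ?thesis
    using step[OF S] by (intro tendsto_lowerbound) auto
qed

end

end

section \<open>From the Markov process to kernel integrals\<close>

text \<open>The event that the return time exceeds \<open>t\<close>. Time 0 is excluded, as in
  \<open>return_time\<close>, so \<open>t = 0\<close> gives the whole space. The event is known at
  time \<open>t\<close>, so the Markov property at \<open>t\<close> applies to it.\<close>

definition avoids :: "'w measure \<Rightarrow> (nat \<Rightarrow> 'w \<Rightarrow> 'a) \<Rightarrow> 'a set \<Rightarrow> nat \<Rightarrow> 'w set" where
  "avoids M X S t = {\<omega> \<in> space M. \<forall>s\<in>{1..t}. X s \<omega> \<notin> S}"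

context markov_process
begin

lemma sets_law [measurable_cong]: "sets (P x) = sets M"
  using law[of x] by (simp add: space_prob_algebra)

lemma space_law: "space (P x) = space M"
  by (rule sets_eq_imp_space_eq[OF sets_law])

lemma subalgebra_natural_filtration: "subalgebra (P x) (natural_filtration M X t)"
proof -
  have "{X s -` A \<inter> space M | s A. s \<le> t \<and> A \<in> sets borel} \<subseteq> sets M"
    using process_measurable by (auto intro: measurable_sets)
  then show ?thesis
    unfolding subalgebra_def natural_filtration_def
    by (simp add: space_law sets_law sets.sigma_sets_subset space_measure_of_conv
        sets_measure_of sets.space_closed subset_trans)
qed

lemma avoids_adapted:
  assumes "S \<in> sets borel"
  shows "avoids M X S t \<in> sets (natural_filtration M X t)"
proof -
  have space: "space (natural_filtration M X t) = space M"
    by (simp add: natural_filtration_def space_measure_of_conv)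
  have "{\<omega> \<in> space M. X s \<omega> \<notin> S} \<in> sets (natural_filtration M X t)" if "s \<le> t" for s
    unfolding natural_filtration_def using that assms
    by (intro in_measure_of) (auto intro!: exI[of _ s] exI[of _ "- S"])
  then show ?thesis
    unfolding avoids_def space[symmetric]
    by (intro sets.sets_Collect_finite_All) auto
qed

text \<open>The Markov property is assumed for indicators of sets only; linearity and monotone
  convergence extend it to nonnegative Borel functions.\<close>

lemma markov_nn_integral:
  assumes C: "C \<in> sets (natural_filtration M X t)"
    and "g \<in> borel_measurable borel"
  shows "(\<integral>\<^sup>+\<omega>. indicator C \<omega> * g (X (Suc t) \<omega>) \<partial>P x)
    = (\<integral>\<^sup>+\<omega>. indicator C \<omega> * (\<integral>\<^sup>+y. g y \<partial>Q (X t \<omega>)) \<partial>P x)"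
  using assms(2)
proof (induction g rule: borel_measurable_induct)
  note [measurable] = process_measurable
  have [measurable]: "C \<in> sets M"
    using C subalgebra_natural_filtration[of x t] by (auto simp: subalgebra_def sets_law)
  have [measurable]: "(\<lambda>\<omega>. \<integral>\<^sup>+y. h y \<partial>Q (X t \<omega>)) \<in> borel_measurable M"
    if "h \<in> borel_measurable borel" for h
    using measurable_compose[OF process_measurable nn_integral_kernel_measurable[OF kernel that]] .
  have Q_measurable: "h \<in> borel_measurable (Q z)" if "h \<in> borel_measurable borel" for h z
    using that by (simp cong: measurable_cong_sets[OF sets_kernel[OF kernel] refl])
  {
    case (cong f g)
    then show ?case by simp
  next
    \<comment> \<open>The only case that uses \<open>markov\<close>: as \<open>C\<close> belongs to
      the filtration at time \<open>t\<close>, the indicator may be replaced by its conditional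
      expectation under the integral over \<open>C\<close>. Since \<open>real_cond_exp\<close> is
      real-valued, the integrals are converted to Bochner integrals and back.\<close>
    case (set A)
    interpret prob_space "P x" using law[of x] by (simp add: space_prob_algebra)
    interpret sigma_finite_subalgebra "P x" "natural_filtration M X t"
      by (intro finite_measure_subalgebra_is_sigma_finite
          finite_measure_subalgebra.intro finite_measure_subalgebra_axioms.intro
          subalgebra_natural_filtration) unfold_locales
    let ?I = "indicator (X (Suc t) -` A \<inter> space M) :: 'w \<Rightarrow> real"
    have [measurable]: "A \<in> sets borel" by fact
    have [measurable]: "(\<lambda>\<omega>. measure (Q (X t \<omega>)) A) \<in> borel_measurable M"
      using measurable_compose[OF process_measurable
          measure_measurable_subprob_algebra2[OF _ measurable_prob_algebraD[OF kernel], of "\<lambda>_. A"]]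
      by simp
    have int: "integrable (P x) ?I"
      by (rule integrable_const_bound[of _ 1]) (auto simp: indicator_def)
    have le1: "measure (Q y) A \<le> 1" for y
      using prob_space.prob_le_1[OF prob_space_kernel[OF kernel]] .
    have int': "integrable (P x) (\<lambda>\<omega>. indicator C \<omega> * measure (Q (X t \<omega>)) A)"
      by (rule integrable_const_bound[of _ 1]) (auto simp: indicator_def le1)
    have "(\<integral>\<^sup>+\<omega>. indicator C \<omega> * indicator A (X (Suc t) \<omega>) \<partial>P x)
        = (\<integral>\<^sup>+\<omega>. ennreal (indicator C \<omega> * ?I \<omega>) \<partial>P x)"
      by (intro nn_integral_cong) (auto simp: indicator_def space_law)
    also have "\<dots> = ennreal (\<integral>\<omega>. indicator C \<omega> * ?I \<omega> \<partial>P x)"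
      by (intro nn_integral_eq_integral integrable_const_bound[of _ 1]) (auto simp: indicator_def)
    also have "(\<integral>\<omega>. indicator C \<omega> * ?I \<omega> \<partial>P x)
        = (\<integral>\<omega>. indicator C \<omega> * real_cond_exp (P x) (natural_filtration M X t) ?I \<omega> \<partial>P x)"
      using real_cond_exp_intA[OF int C] by (simp add: set_lebesgue_integral_def)
    also have "\<dots> = (\<integral>\<omega>. indicator C \<omega> * measure (Q (X t \<omega>)) A \<partial>P x)"
      using markov[OF \<open>A \<in> sets borel\<close>, of x t] by (intro integral_cong_AE) auto
    also have "ennreal \<dots> = (\<integral>\<^sup>+\<omega>. ennreal (indicator C \<omega> * measure (Q (X t \<omega>)) A) \<partial>P x)"
      by (intro nn_integral_eq_integral[symmetric] int') auto
    also have "\<dots> = (\<integral>\<^sup>+\<omega>. indicator C \<omega> * (\<integral>\<^sup>+y. indicator A y \<partial>Q (X t \<omega>)) \<partial>P x)"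
      using finite_measure.emeasure_eq_measure[OF prob_space.finite_measure[OF prob_space_kernel[OF kernel]]]
      by (intro nn_integral_cong) (simp add: sets_kernel[OF kernel] ennreal_mult ennreal_indicator)
    finally show ?case .
  next
    case (mult u c)
    then have [measurable]: "u \<in> borel_measurable borel" by simp
    have "(\<integral>\<^sup>+\<omega>. indicator C \<omega> * (c * u (X (Suc t) \<omega>)) \<partial>P x)
        = c * (\<integral>\<^sup>+\<omega>. indicator C \<omega> * u (X (Suc t) \<omega>) \<partial>P x)"
      by (subst nn_integral_cmult[symmetric]) (auto simp: mult_ac)
    also have "\<dots> = (\<integral>\<^sup>+\<omega>. indicator C \<omega> * (c * (\<integral>\<^sup>+y. u y \<partial>Q (X t \<omega>))) \<partial>P x)"
      unfolding mult by (subst nn_integral_cmult[symmetric]) (auto simp: mult_ac)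
    finally show ?case by (simp add: nn_integral_cmult[OF Q_measurable])
  next
    case (add u v)
    then have [measurable]: "u \<in> borel_measurable borel" "v \<in> borel_measurable borel" by simp_all
    show ?case
      by (simp add: nn_integral_add[OF Q_measurable Q_measurable] nn_integral_add distrib_left add)
  next
    case (seq U)
    then have [measurable]: "\<And>i. U i \<in> borel_measurable borel" by simp
    have mono: "incseq (\<lambda>i \<omega>. indicator C \<omega> * U i (X (Suc t) \<omega>))"
      "incseq (\<lambda>i \<omega>. indicator C \<omega> * (\<integral>\<^sup>+y. U i y \<partial>Q (X t \<omega>)))"
      using \<open>incseq U\<close>
      by (auto simp: incseq_def le_fun_def intro!: mult_left_mono nn_integral_mono)
    have "(\<integral>\<^sup>+\<omega>. indicator C \<omega> * (SUP i. U i) (X (Suc t) \<omega>) \<partial>P x)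
        = (\<integral>\<^sup>+\<omega>. (SUP i. indicator C \<omega> * U i (X (Suc t) \<omega>)) \<partial>P x)"
      by (simp add: SUP_mult_left_ennreal image_comp)
    also have "\<dots> = (SUP i. \<integral>\<^sup>+\<omega>. indicator C \<omega> * U i (X (Suc t) \<omega>) \<partial>P x)"
      by (rule nn_integral_monotone_convergence_SUP[OF mono(1)]) measurable
    also have "\<dots> = (SUP i. \<integral>\<^sup>+\<omega>. indicator C \<omega> * (\<integral>\<^sup>+y. U i y \<partial>Q (X t \<omega>)) \<partial>P x)"
      using seq by simp
    also have "\<dots> = (\<integral>\<^sup>+\<omega>. (SUP i. indicator C \<omega> * (\<integral>\<^sup>+y. U i y \<partial>Q (X t \<omega>))) \<partial>P x)"
      by (rule nn_integral_monotone_convergence_SUP[OF mono(2), symmetric]) measurable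
    also have "\<dots> = (\<integral>\<^sup>+\<omega>. indicator C \<omega> * (\<integral>\<^sup>+y. (SUP i. U i) y \<partial>Q (X t \<omega>)) \<partial>P x)"
    proof -
      have "(\<integral>\<^sup>+y. (SUP i. U i) y \<partial>Q z) = (SUP i. \<integral>\<^sup>+y. U i y \<partial>Q z)" for z
        using nn_integral_monotone_convergence_SUP[OF \<open>incseq U\<close> Q_measurable, of z]
        by (simp add: image_comp)
      then show ?thesis by (simp only: SUP_mult_left_ennreal)
    qed
    finally show ?case .
  }
qed

text \<open>Each use of the Markov property turns the last step of the path into one more kernel
  integral, trading (\<open>Suc t\<close>, \<open>m\<close>) for (\<open>t\<close>,
  \<open>Suc m\<close>). At \<open>t = 0\<close> the process sits at \<open>x\<close>.\<close>

lemma nn_integral_avoids: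
  assumes [measurable]: "S \<in> sets borel" "f \<in> borel_measurable borel"
  shows "(\<integral>\<^sup>+\<omega>. indicator (avoids M X S t) \<omega> * first_return_payoff Q f S m (X t \<omega>) \<partial>P x)
    = first_return_payoff Q f S (m + t) x"
proof (induction t arbitrary: m)
  case 0
  interpret prob_space "P x" using law[of x] by (simp add: space_prob_algebra)
  have "(\<integral>\<^sup>+\<omega>. indicator (avoids M X S 0) \<omega> * first_return_payoff Q f S m (X 0 \<omega>) \<partial>P x)
      = (\<integral>\<^sup>+\<omega>. first_return_payoff Q f S m x \<partial>P x)"
    by (rule nn_integral_cong_AE)
      (use start[of x] AE_space[of "P x"] in eventually_elim, auto simp: avoids_def space_law indicator_def)
  then show ?case by (simp add: emeasure_space_1)
next
  case (Suc t)
  note [measurable] = first_return_payoff_measurable[OF kernel]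
  have "(\<integral>\<^sup>+\<omega>. indicator (avoids M X S (Suc t)) \<omega> * first_return_payoff Q f S m (X (Suc t) \<omega>) \<partial>P x)
      = (\<integral>\<^sup>+\<omega>. indicator (avoids M X S t) \<omega> *
          (indicator (- S) (X (Suc t) \<omega>) * first_return_payoff Q f S m (X (Suc t) \<omega>)) \<partial>P x)"
    by (intro nn_integral_cong) (auto simp: avoids_def indicator_def atLeastAtMostSuc_conv)
  also have "\<dots> = (\<integral>\<^sup>+\<omega>. indicator (avoids M X S t) \<omega> *
      first_return_payoff Q f S (Suc m) (X t \<omega>) \<partial>P x)"
    by (subst markov_nn_integral) (auto intro: avoids_adapted)
  finally show ?case using Suc[of "Suc m"] by simp
qed

text \<open>At most one term is nonzero, the one with
  \<open>return_time X S \<omega> = t + 1\<close>. Without a return all terms vanish, in agreement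
  with the value 0 at infinity.\<close>

lemma stopped_payoff_eq_suminf:
  fixes f :: "'a \<Rightarrow> real"
  assumes "\<omega> \<in> space M" and "\<And>k. 0 \<le> \<delta> k" and "\<And>y. 0 \<le> f y"
  shows "ennreal (case return_time X S \<omega> of enat t \<Rightarrow> \<delta> t * f (X t \<omega>) | \<infinity> \<Rightarrow> 0)
    = (\<Sum>t. ennreal (\<delta> (Suc t)) * (indicator (avoids M X S t) \<omega> *
        (indicator S (X (Suc t) \<omega>) * ennreal (f (X (Suc t) \<omega>)))))"
    (is "_ = (\<Sum>t. ?term t)")
proof (cases "\<exists>t. X (Suc t) \<omega> \<in> S")
  case False
  then have "X t \<omega> \<notin> S" if "1 \<le> t" for t
    using that by (cases t) auto
  then have "return_time X S \<omega> = \<infinity>"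
    by (auto simp: return_time_def Inf_enat_def)
  moreover have "?term t = 0" for t using False by (simp add: indicator_def)
  ultimately show ?thesis by (simp only: enat.case suminf_zero ennreal_0)
next
  case True
  define n where "n = (LEAST t. X (Suc t) \<omega> \<in> S)"
  have n: "X (Suc n) \<omega> \<in> S" "\<And>t. t < n \<Longrightarrow> X (Suc t) \<omega> \<notin> S"
    unfolding n_def using LeastI_ex[OF True] not_less_Least by auto
  then have later: "Suc n \<le> t" if "1 \<le> t" "X t \<omega> \<in> S" for t
    using that by (cases t) (auto simp: not_less[symmetric])
  have "return_time X S \<omega> = enat (Suc n)"
    unfolding return_time_def
    by (rule antisym) (use n later in \<open>auto intro!: Inf_lower Inf_greatest\<close>)
  \<comment> \<open>Before \<open>n\<close> the path is not in \<open>S\<close> at time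
    \<open>Suc t\<close>; after \<open>n\<close> the visit at time \<open>Suc n\<close> lies in
    \<open>{1..t}\<close> and violates \<open>avoids\<close>.\<close>
  moreover have "?term t = 0" if "t \<noteq> n" for t
  proof (cases "t < n")
    case True
    then show ?thesis using n by simp
  next
    case False
    then have "\<omega> \<notin> avoids M X S t"
      using n(1) that by (auto simp: avoids_def intro!: bexI[of _ "Suc n"])
    then show ?thesis by simp
  qed
  then have "(\<Sum>t. ?term t) = (\<Sum>t\<in>{n}. ?term t)"
    by (intro suminf_finite) auto
  moreover have "\<omega> \<in> avoids M X S n"
    using later assms(1) by (fastforce simp: avoids_def)
  ultimately show ?thesis
    using n(1) assms by (simp add: ennreal_mult)
qed

text \<open>Integrating the pathwise series term by term turns J into a quantity of the kernel
  alone; all later arguments work on that side.\<close>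

lemma expected_payoff_eq:
  assumes S [measurable]: "S \<in> sets borel" and f [measurable]: "f \<in> borel_measurable borel"
    and nonneg: "\<And>k. 0 \<le> \<delta> k" "\<And>y. 0 \<le> f y"
  shows "expected_payoff P X \<delta> f x (return_time X S)
    = enn2real (delayed_payoff Q \<delta> (\<lambda>y. ennreal (f y)) S 0 x)"
proof -
  note [measurable] = process_measurable
  define h where "h \<omega> = (case return_time X S \<omega> of enat t \<Rightarrow> \<delta> t * f (X t \<omega>) | \<infinity> \<Rightarrow> 0)" for \<omega>
  define u where "u t \<omega> = indicator (avoids M X S t) \<omega> *
    (indicator S (X (Suc t) \<omega>) * ennreal (f (X (Suc t) \<omega>)))" for t \<omega>
  have h_nonneg: "0 \<le> h \<omega>" for \<omega>
    by (auto simp: h_def nonneg split: enat.split)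
  have h_eq: "ennreal (h \<omega>) = (\<Sum>t. ennreal (\<delta> (Suc t)) * u t \<omega>)" if "\<omega> \<in> space M" for \<omega>
    using stopped_payoff_eq_suminf[OF that] nonneg by (simp add: h_def u_def)
  have [measurable]: "avoids M X S t \<in> sets M" for t
    using avoids_adapted[OF S, of t] subalgebra_natural_filtration[of x t]
    by (auto simp: subalgebra_def sets_law)
  have u [measurable]: "u t \<in> borel_measurable M" for t
    unfolding u_def by measurable
  \<comment> \<open>Measurability of the stopped payoff is read off from the series, whose terms are
    visibly measurable.\<close>
  have "h \<omega> = enn2real (\<Sum>t. ennreal (\<delta> (Suc t)) * u t \<omega>)" if "\<omega> \<in> space M" for \<omega>
    using h_eq[OF that, symmetric] h_nonneg by simp
  then have [measurable]: "h \<in> borel_measurable M"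
    by (subst measurable_cong) auto
  have u_integral: "(\<integral>\<^sup>+\<omega>. u t \<omega> \<partial>P x) = first_return_payoff Q (\<lambda>y. ennreal (f y)) S t x" for t
    unfolding u_def
    using nn_integral_avoids[OF S, where f = "\<lambda>y. ennreal (f y)" and m = 0]
    by (subst markov_nn_integral) (auto intro: avoids_adapted)
  have "expected_payoff P X \<delta> f x (return_time X S) = (\<integral>\<omega>. h \<omega> \<partial>P x)"
    unfolding expected_payoff_def h_def ..
  \<comment> \<open>An infinite value would do no harm: the Bochner integral and
    \<open>enn2real\<close> both default to 0.\<close>
  also have "\<dots> = enn2real (\<integral>\<^sup>+\<omega>. ennreal (h \<omega>) \<partial>P x)"
    by (rule integral_eq_nn_integral) (auto simp: h_nonneg)
  also have "(\<integral>\<^sup>+\<omega>. ennreal (h \<omega>) \<partial>P x) = (\<integral>\<^sup>+\<omega>. (\<Sum>t. ennreal (\<delta> (Suc t)) * u t \<omega>) \<partial>P x)"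
    by (intro nn_integral_cong h_eq) (simp add: space_law)
  also have "\<dots> = (\<Sum>t. ennreal (\<delta> (Suc t)) * (\<integral>\<^sup>+\<omega>. u t \<omega> \<partial>P x))"
    by (subst nn_integral_suminf) (auto simp: nn_integral_cmult)
  also have "\<dots> = delayed_payoff Q \<delta> (\<lambda>y. ennreal (f y)) S 0 x"
    by (simp add: u_integral delayed_payoff_def)
  finally show ?thesis .
qed

end

section \<open>Continuity of kernel integrals and closed superlevel sets\<close>

text \<open>The liminf bound for \<open>- g\<close> is a limsup bound for \<open>g\<close>, so the
  integrals converge along every sequence; in a metric space this is continuity.\<close>

lemma kernel_integral_continuous:
  fixes Q :: "'a::metric_space \<Rightarrow> 'a measure"
  assumes liminf: "\<And>(g :: 'a \<Rightarrow> real) u x.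
           g \<in> borel_measurable borel \<Longrightarrow> bounded (range g) \<Longrightarrow> u \<longlonglongrightarrow> x \<Longrightarrow>
           liminf (\<lambda>n. ereal (\<integral>y. g y \<partial>Q (u n))) \<ge> ereal (\<integral>y. g y \<partial>Q x)"
    and g: "(g :: 'a \<Rightarrow> real) \<in> borel_measurable borel" "bounded (range g)"
  shows "isCont (\<lambda>x. \<integral>y. g y \<partial>Q x) x"
  unfolding continuous_at_sequentially
proof (intro allI impI)
  fix u assume u: "u \<longlonglongrightarrow> x"
  have "bounded (range (\<lambda>y. - g y))"
    using g(2) by (simp add: bounded_iff)
  with g u have "ereal (\<integral>y. - g y \<partial>Q x) \<le> liminf (\<lambda>n. ereal (\<integral>y. - g y \<partial>Q (u n)))"
    by (intro liminf) auto
  then have "limsup (\<lambda>n. ereal (\<integral>y. g y \<partial>Q (u n))) \<le> ereal (\<integral>y. g y \<partial>Q x)"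
    by (simp add: ereal_Liminf_uminus uminus_ereal.simps(1)[symmetric] del: uminus_ereal.simps)
  with liminf[OF g u] have "(\<lambda>n. \<integral>y. g y \<partial>Q (u n)) \<longlonglongrightarrow> (\<integral>y. g y \<partial>Q x)"
    by (intro limsup_le_liminf_real)
  then show "((\<lambda>x. \<integral>y. g y \<partial>Q x) \<circ> u) \<longlonglongrightarrow> (\<integral>y. g y \<partial>Q x)"
    by (simp add: o_def)
qed

text \<open>If \<open>f x < c < g x\<close>, then \<open>f < c\<close> and \<open>c < g\<close> both
  persist near \<open>x\<close>, so the complement is open.\<close>

lemma closed_le_upper_semicontinuous:
  assumes f: "upper_semicontinuous f" and g: "\<And>x. isCont g x"
  shows "closed {x. (g x :: real) \<le> f x}"
  unfolding closed_def open_subopen[of "- _"]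
proof (intro ballI)
  fix x assume "x \<in> - {x. g x \<le> f x}"
  then obtain c where c: "f x < c" "c < g x" by (auto simp: not_le dest: dense)
  have "Limsup (at x) (\<lambda>y. ereal (f y)) < ereal c"
    using f c(1) by (auto simp: upper_semicontinuous_def intro: le_less_trans)
  then have "eventually (\<lambda>y. f y < c) (at x)"
    by (auto dest: Limsup_lessD)
  moreover have "eventually (\<lambda>y. c < g y) (at x)"
    using g[of x] c(2) unfolding isCont_def by (rule order_tendstoD)
  ultimately have "eventually (\<lambda>y. f y < g y) (at x)"
    by eventually_elim auto
  \<comment> \<open>Both estimates concern the punctured neighbourhood; \<open>x\<close> itself is
    covered by the choice of \<open>c\<close>.\<close>
  with c have "eventually (\<lambda>y. f y < g y) (nhds x)"
    by (auto simp: eventually_at_filter elim!: eventually_mono)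
  then show "\<exists>T. open T \<and> x \<in> T \<and> T \<subseteq> - {x. g x \<le> f x}"
    by (auto simp: eventually_nhds subset_eq not_le)
qed

section \<open>Existence, minimality and uniqueness of the optimal equilibrium\<close>

theorem theorem4p1:
  fixes M :: "'w measure"
    and P :: "'a::polish_space \<Rightarrow> 'w measure"
    and X :: "nat \<Rightarrow> 'w \<Rightarrow> 'a"
    and Q :: "'a \<Rightarrow> 'a measure"
    and f :: "'a \<Rightarrow> real"
    and \<delta> :: "nat \<Rightarrow> real"
  assumes "markov_process M P X Q"
    and "f \<in> borel_measurable borel"
    and "\<And>x. 0 \<le> f x"
    and "bounded (range f)"
    and "\<And>k. \<delta> k \<in> {0..1}"
    and "strict_antimono_on UNIV \<delta>"
    and "\<delta> 0 = 1"
    and "\<delta> \<longlonglongrightarrow> 0"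
    and "\<And>i j. \<delta> i * \<delta> j \<le> \<delta> (i + j)"
    and "upper_semicontinuous f"
    and "\<And>(g :: 'a \<Rightarrow> real) u x.
           g \<in> borel_measurable borel \<Longrightarrow> bounded (range g) \<Longrightarrow> u \<longlonglongrightarrow> x \<Longrightarrow>
           liminf (\<lambda>n. ereal (\<integral>y. g y \<partial>Q (u n))) \<ge> ereal (\<integral>y. g y \<partial>Q x)"
  shows "optimal_equilibrium P X \<delta> f (\<Inter>(equilibria P X \<delta> f)) \<and>
         (\<forall>T. optimal_equilibrium P X \<delta> f T \<longrightarrow> T = \<Inter>(equilibria P X \<delta> f))"
proof -
  interpret markov_process M P X Q by fact
  note f [measurable] = assms(2) and nonneg = assms(3) and supermult = assms(9)
  obtain B where B: "f x \<le> B" for x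
    using assms(4) by (auto simp: bounded_iff abs_le_iff)
  have \<delta>: "0 \<le> \<delta> k" "\<delta> k \<le> 1" for k
    using assms(5)[of k] by auto
  have antimono: "antimono \<delta>"
    using assms(6) by (auto simp: monotone_on_def antimono_def le_less)
  define J where "J S x = expected_payoff P X \<delta> f x (return_time X S)" for S x
  define D where "D S k = delayed_payoff Q \<delta> (\<lambda>y. ennreal (f y)) S k" for S k
  have fB: "ennreal (f y) \<le> ennreal B" for y
    by (intro ennreal_leI B)
  \<comment> \<open>The bound makes \<open>D\<close> finite, so that no information is lost between
    \<open>J\<close> and \<open>D\<close>.\<close>
  have D_le: "D S k y \<le> ennreal B" if "S \<in> sets borel" for S k y
  proof -
    have "D S k y \<le> ennreal (\<delta> (Suc k)) * ennreal B"
      unfolding D_def by (intro delayed_payoff_le kernel that fB antimono) measurable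
    also have "\<dots> \<le> 1 * ennreal B"
      using \<delta>[of "Suc k"] by (intro mult_right_mono) auto
    finally show ?thesis by simp
  qed
  have J_eq: "ennreal (J S x) = D S 0 x" if "S \<in> sets borel" for S x
  proof -
    have "D S 0 x < top"
      using D_le[OF that, of 0 x] by (auto simp: less_top[symmetric] top_unique)
    then show ?thesis
      using expected_payoff_eq[OF that f \<delta>(1) nonneg] by (simp add: J_def D_def)
  qed
  have J_nonneg: "0 \<le> J S x" for S x
    unfolding J_def expected_payoff_def
    by (intro integral_nonneg_AE) (auto simp: nonneg \<delta> split: enat.split)
  have Theta: "Theta P X \<delta> f S = {x. J S x \<le> f x}" for S
    by (simp add: Theta_def J_def)

  \<comment> \<open>The comparison is kept for a family \<open>F\<close> because it is used twice:
    with all good sets against their intersection, and with \<open>{R}\<close> against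
    \<open>\<Theta>(R)\<close>.\<close>
  have J_mono: "J S x \<le> J R x"
    if R: "R \<in> sets borel" and F: "F \<subseteq> sets borel" "\<And>S. S \<in> F \<Longrightarrow> R \<subseteq> S"
      and continue: "\<And>y. y \<notin> R \<Longrightarrow> \<exists>S\<in>F. f y \<le> J S y" and S: "S \<in> F" for R F S x
  proof -
    have "\<exists>S\<in>F. ennreal (f y) \<le> D S 0 y" if "y \<notin> R" for y
      using continue[OF that] F(1) by (force simp: J_eq[symmetric] intro: ennreal_leI)
    then have "D S 0 x \<le> D R 0 x"
      unfolding D_def
      by (intro delayed_payoff_mono[OF kernel _ R F(1,2) _ fB antimono assms(8) \<delta>(1) supermult S]) auto
    then have "ennreal (J S x) \<le> ennreal (J R x)"
      using F(1) S R by (auto simp: J_eq)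
    then show ?thesis by (simp add: J_nonneg)
  qed

  have closed_Theta: "closed (Theta P X \<delta> f S)" if S [measurable]: "S \<in> sets borel" for S
  proof -
    \<comment> \<open>The integrand of the one-step recursion at delay 0. It is bounded and Borel
      for every Borel \<open>S\<close>, so \<open>J S\<close>, being its kernel integral, is
      continuous.\<close>
    define h where "h y = enn2real (ennreal (\<delta> 1) * (indicator S y * ennreal (f y))
        + indicator (- S) y * D S 1 y)" for y
    have D [measurable]: "D S k \<in> borel_measurable borel" for k
      unfolding D_def by (intro delayed_payoff_measurable kernel S) measurable
    have h_le: "ennreal (\<delta> 1) * (indicator S y * ennreal (f y)) + indicator (- S) y * D S 1 y
        \<le> ennreal B" for y
      using fB[of y] D_le[OF S, of 1 y] \<delta>[of 1] mult_mono[of "ennreal (\<delta> 1)" 1 "ennreal (f y)" "ennreal B"]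
      by (auto simp: indicator_def)
    then have h: "ennreal (h y) = ennreal (\<delta> 1) * (indicator S y * ennreal (f y)) + indicator (- S) y * D S 1 y" for y
      unfolding h_def by (intro ennreal_enn2real le_less_trans[OF h_le ennreal_less_top])
    have h_meas: "h \<in> borel_measurable borel"
      unfolding h_def by measurable
    \<comment> \<open>Any point of the space will do; the sign is needed to drop
      \<open>ennreal\<close> from the bound on \<open>h\<close>.\<close>
    have "0 \<le> B" using nonneg[of undefined] B[of undefined] by simp
    then have "h y \<le> B" for y
      using h_le[of y] unfolding h[symmetric] by (simp add: h_def)
    then have h_bounded: "bounded (range h)"
      by (auto simp: bounded_iff h_def intro!: exI[of _ B])
    have "J S x = (\<integral>y. h y \<partial>Q x)" for x
    proof -
      have "J S x = enn2real (D S 0 x)"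
        using J_eq[OF S] J_nonneg by (metis enn2real_ennreal)
      also have "D S 0 x = (\<integral>\<^sup>+y. ennreal (h y) \<partial>Q x)"
        unfolding h unfolding D_def using delayed_payoff_rec[OF kernel _ S, of "\<lambda>y. ennreal (f y)" \<delta> 0 x] by simp
      also have "enn2real \<dots> = (\<integral>y. h y \<partial>Q x)"
        using h_meas by (intro integral_eq_nn_integral[symmetric])
          (auto simp: h_def cong: measurable_cong_sets[OF sets_kernel[OF kernel] refl])
      finally show ?thesis .
    qed
    then have "J S = (\<lambda>x. \<integral>y. h y \<partial>Q x)" ..
    then have "isCont (J S) x" for x
      using kernel_integral_continuous[OF assms(11) h_meas h_bounded] by simp
    then show ?thesis
      unfolding Theta by (rule closed_le_upper_semicontinuous[OF assms(10)])
  qed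

  \<comment> \<open>Closedness keeps an arbitrary, possibly uncountable, intersection Borel.\<close>
  define G where "G = {R. closed R \<and> Theta P X \<delta> f R \<subseteq> R}"
  define R where "R = \<Inter>G"
  have G_borel: "G \<subseteq> sets borel" by (auto simp: G_def)
  have R_borel: "R \<in> sets borel"
    by (auto simp: R_def G_def intro!: closed_Inter borel_closed)
  have stop_outside: "\<exists>S\<in>G. f y \<le> J S y" if "y \<notin> R" for y
  proof -
    from that obtain S where "S \<in> G" "y \<notin> S" by (auto simp: R_def)
    then have "y \<notin> Theta P X \<delta> f S" by (auto simp: G_def)
    with \<open>S \<in> G\<close> show ?thesis by (intro bexI[of _ S]) (auto simp: Theta)
  qed
  have J_le_R: "J S x \<le> J R x" if "S \<in> G" for S x
    using that by (intro J_mono[OF R_borel G_borel _ stop_outside]) (auto simp: R_def)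
  have "Theta P X \<delta> f R \<subseteq> R"
  proof
    fix x assume x: "x \<in> Theta P X \<delta> f R"
    have "x \<in> S" if "S \<in> G" for S
      using x J_le_R[OF that, of x] that by (auto simp: Theta G_def)
    then show "x \<in> R" by (simp add: R_def)
  qed
  moreover have "R \<subseteq> Theta P X \<delta> f R"
  proof -
    let ?R = "Theta P X \<delta> f R"
    \<comment> \<open>Outside \<open>?R\<close> continuing with \<open>R\<close> beats stopping by
      the very definition of \<open>Theta\<close>, so \<open>{R}\<close> is an admissible
      family.\<close>
    have "J R x \<le> J ?R x" for x
      using \<open>?R \<subseteq> R\<close> R_borel closed_Theta[OF R_borel]
      by (intro J_mono[of ?R "{R}"]) (auto simp: Theta)
    then have "Theta P X \<delta> f ?R \<subseteq> ?R"
      unfolding Theta[of ?R] unfolding Theta[of R] by (blast intro: order_trans)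
    then have "?R \<in> G" using closed_Theta[OF R_borel] by (simp add: G_def)
    then show ?thesis by (auto simp: R_def)
  qed
  ultimately have R_eq: "Theta P X \<delta> f R = R" by simp
  \<comment> \<open>An equilibrium equals its own \<open>Theta\<close>, hence is closed.\<close>
  have equilibria_G: "equilibria P X \<delta> f \<subseteq> G"
    using closed_Theta by (force simp: equilibria_def G_def)
  have R_equilibrium: "R \<in> equilibria P X \<delta> f"
    using R_borel R_eq by (simp add: equilibria_def)
  have Inter_eq: "\<Inter>(equilibria P X \<delta> f) = R"
    using equilibria_G R_equilibrium by (auto simp: R_def)
  have V: "value_function P X \<delta> f x S = max (f x) (J S x)" for x S
    by (simp add: value_function_def J_def)
  have "optimal_equilibrium P X \<delta> f R"
    unfolding optimal_equilibrium_def V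
    using R_equilibrium equilibria_G J_le_R by (auto intro!: max.mono simp del: max.bounded_iff)
  \<comment> \<open>Two optimal equilibria dominate each other and share one value function. It
    equals \<open>f\<close> exactly on \<open>Theta\<close>, and each of the two sets is its own
    \<open>Theta\<close>.\<close>
  moreover have "T = R" if T: "optimal_equilibrium P X \<delta> f T" for T
  proof -
    have "max (f x) (J T x) = max (f x) (J R x)" for x
      using T \<open>optimal_equilibrium P X \<delta> f R\<close>
      by (intro antisym) (auto simp: optimal_equilibrium_def V simp del: max.bounded_iff)
    then have "J T x \<le> f x \<longleftrightarrow> J R x \<le> f x" for x
      by (metis max.absorb_iff1)
    then have "Theta P X \<delta> f T = Theta P X \<delta> f R" by (simp add: Theta)
    then show ?thesis
      using T R_eq by (simp add: optimal_equilibrium_def equilibria_def)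
  qed
  ultimately show ?thesis unfolding Inter_eq by blast
qed

end
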